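(* For every integer $n\ge0$, \[ \tau(n)=2\sum_{\substack{j,k\ge0\\ j+k=n}}(3j-2k)\sigma_3^{*}(j)\sigma_5^{*}(k). \]
   Context: For $n,s\ge1$, $\sigma^{*}_{s}(n)=-\sum_{d\mid n}(-1)^{d}d^{s}$; by convention $\sigma^{*}_3(0)=-\frac1{16}$ and $\sigma^{*}_5(0)=\frac18$. Ramanujan's tau function is defined by $q\prod_{n\ge1}(1-q^n)^{24}=\sum_{n\ge1}\tau(n)q^n$, and $\tau(0)=0$. *)

theory Defs
  imports "HOL-Analysis.Analysis"
begin

text \<open>The product is taken in the usual (X-adic) topology of formal power series; the index is
  shifted by one because \<^const>\<open>prodinf\<close> starts at 0.\<close>

definition tau_fps :: "int fps" where
  "tau_fps = fps_X * (\<Prod>n. (1 - fps_X ^ Suc n) ^ 24)"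

definition ramanujan_tau :: "nat \<Rightarrow> int" where
  "ramanujan_tau n = fps_nth tau_fps n"

text \<open>Of the values at \<open>n = 0\<close>, only those for \<open>s = 3\<close> and \<open>s = 5\<close> are meaningful.\<close>

definition sigma_star :: "nat \<Rightarrow> nat \<Rightarrow> real" where
  "sigma_star s n =
     (if n = 0 then (if s = 3 then - 1 / 16 else if s = 5 then 1 / 8 else undefined)
      else - (\<Sum>d | d dvd n. (- 1) ^ d * real d ^ s))"

text \<open>The infinite product converges, so \<^const>\<open>prodinf\<close> denotes its actual value.\<close>

lemma tau_fps_coeff_stable:
  fixes F :: "nat \<Rightarrow> int fps"
  defines "F \<equiv> (\<lambda>n. (1 - fps_X ^ Suc n) ^ 24)"
  assumes "k \<le> N"
  shows "fps_nth (\<Prod>i\<le>N. F i) k = fps_nth (\<Prod>i\<le>k. F i) k"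
  using assms(2)
proof (induction N rule: dec_induct)
  case (step N)
  have "fps_X ^ Suc (Suc N) dvd 1 - F (Suc N)"
  proof -
    have "(1 - F (Suc N)) = (1 - (1 - fps_X ^ Suc (Suc N))) * (\<Sum>i<24. (1 - fps_X ^ Suc (Suc N)) ^ i)"
      unfolding F_def by (rule one_diff_power_eq)
    also have "1 - (1 - fps_X ^ Suc (Suc N)) = (fps_X ^ Suc (Suc N) :: int fps)"
      by (simp only: diff_diff_eq2 add_diff_cancel_left')
    finally show ?thesis by (rule dvdI)
  qed
  then obtain G where G: "1 - F (Suc N) = fps_X ^ Suc (Suc N) * G" by (elim dvdE)
  have F: "F (Suc N) = 1 - fps_X ^ Suc (Suc N) * G"
    by (simp only: G [symmetric] diff_diff_eq2 add_diff_cancel_left')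
  have "(\<Prod>i\<le>Suc N. F i) = (\<Prod>i\<le>N. F i) - fps_X ^ Suc (Suc N) * (G * (\<Prod>i\<le>N. F i))"
    by (simp only: prod.atMost_Suc F right_diff_distrib mult_1_right mult_1_left mult_ac)
  also have "fps_nth \<dots> k = fps_nth (\<Prod>i\<le>N. F i) k"
    using step.hyps by (simp only: fps_sub_nth fps_X_power_mult_nth) simp
  finally show ?case using step.IH by (simp only:)
qed (rule refl)

lemma tau_fps_has_prod:
  "(\<lambda>n. (1 - fps_X ^ Suc n) ^ 24 :: int fps) has_prod (\<Prod>n. (1 - fps_X ^ Suc n) ^ 24)"
proof -
  define F :: "nat \<Rightarrow> int fps" where "F = (\<lambda>n. (1 - fps_X ^ Suc n) ^ 24)"
  define P where "P = Abs_fps (\<lambda>k. fps_nth (\<Prod>i\<le>k. F i) k)"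
  have "(\<lambda>n. \<Prod>i\<le>n. F i) \<longlonglongrightarrow> P"
  proof (rule tendsto_fpsI)
    fix k
    show "\<forall>\<^sub>F N in sequentially. fps_nth (\<Prod>i\<le>N. F i) k = fps_nth P k"
      using eventually_ge_at_top[of k]
      unfolding P_def fps_nth_Abs_fps F_def by eventually_elim (rule tau_fps_coeff_stable)
  qed
  moreover have "fps_nth P 0 = 1"
  proof -
    have "fps_nth P 0 = fps_nth (F 0) 0"
      by (simp only: P_def fps_nth_Abs_fps) simp
    also have "\<dots> = 1"
      by (simp only: F_def fps_power_zeroth) simp
    finally show ?thesis .
  qed
  ultimately have "F has_prod P"
    by (auto simp: has_prod_def raw_has_prod_def)
  thus ?thesis
    using has_prod_unique [of F P] by (simp only: F_def)
qed

end

theory Submission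
  imports Defs
begin

text \<open>
  Write \<open>\<theta> = q d/dq\<close>, let \<open>P, Q, R\<close> be Ramanujan's Eisenstein series in \<open>q\<close> and \<open>P', Q', R'\<close> the same
  series in \<open>q\<^sup>2\<close>. Liouville's identity for the even functions \<open>x\<^sup>2\<close> and \<open>x\<^sup>4\<close> gives
  \<open>12 \<theta>P = P\<^sup>2 - Q\<close> and \<open>3 \<theta>Q = P Q - R\<close>; for \<open>(-1)\<^sup>x x\<^sup>2\<close> and \<open>(-1)\<^sup>x x\<^sup>4\<close> it gives
  \<open>4 \<theta>U = U\<^sup>2 - V\<close> and \<open>\<theta>V = U V - W\<close>, where \<open>3 U = 4 P' - P\<close>, \<open>15 V = 16 Q' - Q\<close>, \<open>63 W = 64 R' - R\<close>.
  Comparing the two systems, with \<open>C = 2 P' - P\<close>, forces \<open>5 C\<^sup>2 = Q + 4 Q'\<close> and then \<open>W = C V\<close>,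
  \<open>\<theta>V = (U - C) V\<close> and \<open>2 \<theta>C = C U - V\<close>.
  Up to the factor \<open>64\<close>, the right-hand side of the theorem is the coefficient of
  \<open>2 V \<theta>W - 3 W \<theta>V = V\<^sup>2 (C\<^sup>2 - V)\<close>, whose logarithmic derivative is \<open>3 U - 2 C = P\<close>.
  The product defining \<open>\<tau>\<close> has the same logarithmic derivative, and the leading coefficients agree.
\<close>

unbundle no vec_syntax
unbundle fps_syntax

section \<open>Liouville's identity by reindexing the solutions of
  \<open>a * x + b * y = n\<close>\<close>

definition sols :: "nat \<Rightarrow> (nat \<times> nat \<times> nat \<times> nat) set" where
  "sols n = {(a, b, x, y). 0 < a \<and> 0 < b \<and> 0 < x \<and> 0 < y \<and> a * x + b * y = n}"

lemma mem_sols [simp]: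
  "(a, b, x, y) \<in> sols n \<longleftrightarrow> 0 < a \<and> 0 < b \<and> 0 < x \<and> 0 < y \<and> a * x + b * y = n"
  by (simp add: sols_def)

lemma finite_sols: "finite (sols n)"
proof (rule finite_subset)
  show "sols n \<subseteq> {..n} \<times> {..n} \<times> {..n} \<times> {..n}"
  proof
    fix p assume "p \<in> sols n"
    then obtain a b x y where p: "p = (a, b, x, y)" "0 < a" "0 < b" "0 < x" "0 < y"
      "a * x + b * y = n" by (auto simp: sols_def)
    have "a \<le> a * x" "x \<le> a * x" "b \<le> b * y" "y \<le> b * y" using p by auto
    hence "a \<le> n" "x \<le> n" "b \<le> n" "y \<le> n" using p(6) by linarith+
    thus "p \<in> {..n} \<times> {..n} \<times> {..n} \<times> {..n}" using p(1) by auto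
  qed
qed simp

text \<open>The condition may involve all four entries, but the weight sees only \<open>a\<close>
  and \<open>b\<close>; a reindexing has to track just these two in the summand.\<close>

definition sols_sum :: "nat \<Rightarrow> (nat \<Rightarrow> nat \<Rightarrow> nat \<Rightarrow> nat \<Rightarrow> bool) \<Rightarrow> (nat \<Rightarrow> nat \<Rightarrow> real) \<Rightarrow> real" where
  "sols_sum n P g = (\<Sum>(a, b, x, y) \<in> {(a, b, x, y) \<in> sols n. P a b x y}. g a b)"

lemma sols_sum_if:
  "sols_sum n P g = (\<Sum>(a, b, x, y) \<in> sols n. if P a b x y then g a b else 0)"
  unfolding sols_sum_def
  by (rule sum.mono_neutral_cong_left) (auto simp: finite_sols split: if_splits)

lemma sols_sum_trichotomy_coeff:
  "sols_sum n (\<lambda>_ _ _ _. True) g =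
     sols_sum n (\<lambda>a b x y. a = b) g + sols_sum n (\<lambda>a b x y. b < a) g + sols_sum n (\<lambda>a b x y. a < b) g"
  unfolding sols_sum_if sum.distrib [symmetric] by (intro sum.cong) auto

lemma sols_sum_trichotomy_mult:
  "sols_sum n (\<lambda>_ _ _ _. True) g =
     sols_sum n (\<lambda>a b x y. x = y) g + sols_sum n (\<lambda>a b x y. y < x) g + sols_sum n (\<lambda>a b x y. x < y) g"
  unfolding sols_sum_if sum.distrib [symmetric] by (intro sum.cong) auto

lemma sols_sum_swap:
  "sols_sum n P g = sols_sum n (\<lambda>a b x y. P b a y x) (\<lambda>a b. g b a)"
  unfolding sols_sum_def
  by (rule sum.reindex_bij_witness[of _ "\<lambda>(a, b, x, y). (b, a, y, x)" "\<lambda>(a, b, x, y). (b, a, y, x)"])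
     (auto simp: add.commute)

text \<open>Rests on \<open>a * x + b * y = (a - b) * x + b * (x + y)\<close>.\<close>

lemma sols_sum_diff:
  "sols_sum n (\<lambda>a b x y. b < a) (\<lambda>a b. f (a - b)) = sols_sum n (\<lambda>a b x y. x < y) (\<lambda>a b. f a)"
  unfolding sols_sum_def
  by (rule sum.reindex_bij_witness[of _ "\<lambda>(a, b, x, y). (a + b, b, x, y - x)"
        "\<lambda>(a, b, x, y). (a - b, b, x, x + y)"])
     (auto simp: algebra_simps dest!: less_imp_Suc_add)

text \<open>Rests on \<open>a * x + b * y = (a + b) * y + a * (x - y)\<close>.\<close>

lemma sols_sum_add:
  "sols_sum n (\<lambda>a b x y. y < x) (\<lambda>a b. f (a + b)) = sols_sum n (\<lambda>a b x y. b < a) (\<lambda>a b. f a)"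
  unfolding sols_sum_def
  by (rule sum.reindex_bij_witness[of _ "\<lambda>(a, b, x, y). (b, a - b, x + y, x)"
        "\<lambda>(a, b, x, y). (a + b, a, y, x - y)"])
     (auto simp: algebra_simps dest!: less_imp_Suc_add)

text \<open>Rests on \<open>a * x + b * y = a * (x - y) + (a + b) * y\<close>, which keeps
  \<open>a\<close> and hence the weight.\<close>

lemma sols_sum_shift:
  "sols_sum n (\<lambda>a b x y. y < x) (\<lambda>a b. f a) = sols_sum n (\<lambda>a b x y. a < b) (\<lambda>a b. f a)"
  unfolding sols_sum_def
  by (rule sum.reindex_bij_witness[of _ "\<lambda>(a, b, x, y). (a, b - a, x + y, y)"
        "\<lambda>(a, b, x, y). (a, a + b, x - y, y)"])
     (auto simp: algebra_simps dest!: less_imp_Suc_add)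

lemma sols_sum_cong:
  assumes "\<And>a b x y. (a, b, x, y) \<in> sols n \<Longrightarrow> P a b x y \<Longrightarrow> g a b = h a b"
  shows "sols_sum n P g = sols_sum n P h"
  unfolding sols_sum_def by (rule sum.cong) (use assms in auto)

text \<open>With \<open>a = b = d\<close> the equation reads \<open>d * (x + y) = n\<close>, which
  leaves \<open>n / d - 1\<close> choices of \<open>x\<close>.\<close>

lemma sols_sum_eq_coeff:
  assumes "n > 0"
  shows "sols_sum n (\<lambda>a b x y. a = b) g = (\<Sum>d | d dvd n. (real n / real d - 1) * g d d)"
proof -
  have "sols_sum n (\<lambda>a b x y. a = b) g =
      (\<Sum>(d, x) \<in> (SIGMA d : {d. d dvd n}. {1..<n div d}). g d d)"
    unfolding sols_sum_def
  proof (rule sum.reindex_bij_witness[of _ "\<lambda>(d, x). (d, d, x, n div d - x)" "\<lambda>(a, b, x, y). (a, x)"])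
    fix p assume "p \<in> {(a, b, x, y) \<in> sols n. a = b}"
    then obtain a x y where p: "p = (a, a, x, y)" "0 < a" "0 < x" "0 < y" "a * x + a * y = n"
      by auto
    have n: "n = a * (x + y)" using p(5) by (simp add: algebra_simps)
    show "(case case p of (a, b, x, y) \<Rightarrow> (a, x) of (d, x) \<Rightarrow> (d, d, x, n div d - x)) = p"
      using p by (simp add: n)
    show "(case p of (a, b, x, y) \<Rightarrow> (a, x)) \<in> (SIGMA d : {d. d dvd n}. {1..<n div d})"
      using p by (simp add: n)
  next
    fix p assume "p \<in> (SIGMA d : {d. d dvd n}. {1..<n div d})"
    then obtain d x where p: "p = (d, x)" "d dvd n" "1 \<le> x" "x < n div d" by auto
    from p(2) obtain e where n: "n = d * e" by (elim dvdE)
    have "d > 0" using assms n by (cases d) auto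
    with p n have "x < e" by simp
    then obtain k where "e = Suc (x + k)" by (auto dest: less_imp_Suc_add)
    thus "(case p of (d, x) \<Rightarrow> (d, d, x, n div d - x)) \<in> {(a, b, x, y) \<in> sols n. a = b}"
      using p n \<open>d > 0\<close> by (auto simp: algebra_simps)
  qed auto
  also have "\<dots> = (\<Sum>d | d dvd n. real (n div d - 1) * g d d)"
    using assms by (subst sum.Sigma [symmetric]) auto
  also have "\<dots> = (\<Sum>d | d dvd n. (real n / real d - 1) * g d d)"
  proof (rule sum.cong)
    fix d assume d: "d \<in> {d. d dvd n}"
    hence "n div d \<ge> 1" using assms by (auto elim!: dvdE)
    thus "real (n div d - 1) * g d d = (real n / real d - 1) * g d d"
      using d by (simp add: of_nat_diff real_of_nat_div)
  qed simp
  finally show ?thesis .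
qed

text \<open>With \<open>x = y\<close> the equation reads \<open>(a + b) * x = n\<close>, so
  \<open>d = a + b\<close> runs through the divisors of \<open>n\<close>.\<close>

lemma sols_sum_eq_mult:
  assumes "n > 0"
  shows "sols_sum n (\<lambda>a b x y. x = y) g = (\<Sum>d | d dvd n. \<Sum>a=1..<d. g a (d - a))"
proof -
  have "sols_sum n (\<lambda>a b x y. x = y) g =
      (\<Sum>(d, a) \<in> (SIGMA d : {d. d dvd n}. {1..<d}). g a (d - a))"
    unfolding sols_sum_def
  proof (rule sum.reindex_bij_witness[of _ "\<lambda>(d, a). (a, d - a, n div d, n div d)"
        "\<lambda>(a, b, x, y). (a + b, a)"])
    fix p assume "p \<in> {(a, b, x, y) \<in> sols n. x = y}"
    then obtain a b x where p: "p = (a, b, x, x)" "0 < a" "0 < b" "0 < x" "a * x + b * x = n"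
      by auto
    have n: "n = (a + b) * x" using p(5) by (simp add: algebra_simps)
    show "(case case p of (a, b, x, y) \<Rightarrow> (a + b, a) of (d, a) \<Rightarrow> (a, d - a, n div d, n div d)) = p"
      using p(1-4) by (simp add: n)
    show "(case p of (a, b, x, y) \<Rightarrow> (a + b, a)) \<in> (SIGMA d : {d. d dvd n}. {1..<d})"
      using p(1-4) by (simp add: n)
  next
    fix p assume "p \<in> (SIGMA d : {d. d dvd n}. {1..<d})"
    then obtain d a where p: "p = (d, a)" "d dvd n" "1 \<le> a" "a < d" by auto
    from p(2) obtain e where n: "n = d * e" by (elim dvdE)
    have "e > 0" using assms n by (cases e) auto
    from p(4) obtain k where k: "d = Suc (a + k)" by (auto dest: less_imp_Suc_add)
    have "n div d = e" using p(4) n by simp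
    thus "(case p of (d, a) \<Rightarrow> (a, d - a, n div d, n div d)) \<in> {(a, b, x, y) \<in> sols n. x = y}"
      using p(1,3) n k \<open>e > 0\<close> by (simp add: algebra_simps)
  qed auto
  also have "\<dots> = (\<Sum>d | d dvd n. \<Sum>a=1..<d. g a (d - a))"
    using assms by (subst sum.Sigma [symmetric]) auto
  finally show ?thesis .
qed

text \<open>Liouville's identity for an even function; the truncated differences encode
  \<open>(a - b) + (b - a) = |a - b|\<close>.\<close>

theorem liouville_identity:
  fixes f :: "nat \<Rightarrow> real"
  assumes "n > 0"
  shows "(\<Sum>(a, b, x, y) \<in> sols n. f ((a - b) + (b - a)) - f (a + b)) =
    (\<Sum>d | d dvd n. (real n / real d - 1) * (f 0 + 2 * f d) - (real d - 1) * f d - 2 * (\<Sum>a=1..<d. f a))"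
proof -
  let ?T = "\<lambda>_ _ _ _ :: nat. True"
  let ?D = "\<lambda>a b. f ((a - b) + (b - a))"
  have D: "sols_sum n ?T ?D =
      sols_sum n (\<lambda>a b x y. a = b) (\<lambda>_ _. f 0) + 2 * sols_sum n (\<lambda>a b x y. x < y) (\<lambda>a b. f a)"
  proof -
    have "sols_sum n (\<lambda>a b x y. a = b) ?D = sols_sum n (\<lambda>a b x y. a = b) (\<lambda>_ _. f 0)"
      by (rule sols_sum_cong) auto
    moreover have "sols_sum n (\<lambda>a b x y. b < a) ?D = sols_sum n (\<lambda>a b x y. x < y) (\<lambda>a b. f a)"
      unfolding sols_sum_diff [symmetric] by (rule sols_sum_cong) auto
    moreover have "sols_sum n (\<lambda>a b x y. a < b) ?D = sols_sum n (\<lambda>a b x y. b < a) ?D"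
      by (subst sols_sum_swap) (simp add: add.commute)
    ultimately show ?thesis by (simp add: sols_sum_trichotomy_coeff [of n ?D])
  qed
  have S: "sols_sum n ?T (\<lambda>a b. f (a + b)) =
      sols_sum n (\<lambda>a b x y. x = y) (\<lambda>a b. f (a + b)) + 2 * sols_sum n (\<lambda>a b x y. b < a) (\<lambda>a b. f a)"
  proof -
    have "sols_sum n (\<lambda>a b x y. x < y) (\<lambda>a b. f (a + b)) = sols_sum n (\<lambda>a b x y. y < x) (\<lambda>a b. f (a + b))"
      by (subst sols_sum_swap) (simp add: add.commute)
    thus ?thesis by (simp add: sols_sum_trichotomy_mult [of n "\<lambda>a b. f (a + b)"] sols_sum_add)
  qed
  \<comment> \<open>Neither sum on the left has a closed form, but their difference does: split the
    same total by comparing \<open>a\<close> with \<open>b\<close> and by comparing \<open>x\<close>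
    with \<open>y\<close>; the parts \<open>a < b\<close> and \<open>y < x\<close> cancel by
    \<open>sols_sum_shift\<close>.\<close>
  have E: "sols_sum n (\<lambda>a b x y. x < y) (\<lambda>a b. f a) - sols_sum n (\<lambda>a b x y. b < a) (\<lambda>a b. f a) =
      sols_sum n (\<lambda>a b x y. a = b) (\<lambda>a b. f a) - sols_sum n (\<lambda>a b x y. x = y) (\<lambda>a b. f a)"
    using sols_sum_trichotomy_coeff [of n "\<lambda>a b. f a"] sols_sum_trichotomy_mult [of n "\<lambda>a b. f a"]
      sols_sum_shift [of n f] by linarith
  have M: "sols_sum n (\<lambda>a b x y. x = y) (\<lambda>a b. f (a + b)) = (\<Sum>d | d dvd n. (real d - 1) * f d)"
    unfolding sols_sum_eq_mult [OF assms]
  proof (rule sum.cong)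
    fix d assume "d \<in> {d. d dvd n}"
    hence "d > 0" using assms by (auto intro: Nat.gr0I)
    have "(\<Sum>a=1..<d. f (a + (d - a))) = (\<Sum>a=1..<d. f d)" by (rule sum.cong) auto
    also have "\<dots> = (real d - 1) * f d" using \<open>d > 0\<close> by (simp add: of_nat_diff)
    finally show "(\<Sum>a=1..<d. f (a + (d - a))) = (real d - 1) * f d" .
  qed simp
  have "(\<Sum>(a, b, x, y) \<in> sols n. ?D a b - f (a + b)) = sols_sum n ?T ?D - sols_sum n ?T (\<lambda>a b. f (a + b))"
    unfolding sols_sum_if sum_subtractf [symmetric] by (intro sum.cong) auto
  also have "\<dots> = sols_sum n (\<lambda>a b x y. a = b) (\<lambda>_ _. f 0) - (\<Sum>d | d dvd n. (real d - 1) * f d) +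
      2 * (sols_sum n (\<lambda>a b x y. a = b) (\<lambda>a b. f a) - sols_sum n (\<lambda>a b x y. x = y) (\<lambda>a b. f a))"
    unfolding D S M using E by (simp add: algebra_simps)
  also have "\<dots> = (\<Sum>d | d dvd n. (real n / real d - 1) * (f 0 + 2 * f d) - (real d - 1) * f d
      - 2 * (\<Sum>a=1..<d. f a))"
    unfolding sols_sum_eq_coeff [OF assms] sols_sum_eq_mult [OF assms]
    by (simp add: sum_subtractf sum.distrib sum_distrib_left algebra_simps)
  finally show ?thesis .
qed

section \<open>Lambert series and the operator \<open>theta\<close>\<close>

text \<open>The Lambert series with terms \<open>g d * q^d / (1 - q^d)\<close>, summed over
  \<open>d > 0\<close>.\<close>

definition lambert :: "(nat \<Rightarrow> real) \<Rightarrow> real fps" where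
  "lambert g = Abs_fps (\<lambda>n. if n = 0 then 0 else \<Sum>d | d dvd n. g d)"

lemma lambert_nth: "lambert g $ n = (if n = 0 then 0 else \<Sum>d | d dvd n. g d)"
  by (simp add: lambert_def)

text \<open>This form avoids division and covers \<open>n = 0\<close>, where the index set is empty;
  multiplying two such sums leads directly to \<open>sols\<close>.\<close>

lemma lambert_nth_pairs:
  "lambert g $ n = (\<Sum>(a, x) | 0 < a \<and> 0 < x \<and> a * x = n. g a)"
proof (cases "n = 0")
  case False
  have "(\<Sum>d | d dvd n. g d) = (\<Sum>(a, x) | 0 < a \<and> 0 < x \<and> a * x = n. g a)"
    using False
    by (intro sum.reindex_bij_witness[of _ fst "\<lambda>d. (d, n div d)"])
       (auto intro: Nat.gr0I elim!: dvdE)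
  thus ?thesis using False by (simp add: lambert_nth)
next
  case True
  have e: "{(a, x). 0 < a \<and> 0 < x \<and> a * x = (0::nat)} = {}" by auto
  show ?thesis unfolding True e by (simp add: lambert_nth)
qed

lemma finite_factor_pairs: "finite {(a, x). 0 < a \<and> 0 < x \<and> a * x = (n::nat)}"
proof (rule finite_subset)
  show "{(a, x). 0 < a \<and> 0 < x \<and> a * x = n} \<subseteq> {..n} \<times> {..n}" by auto
qed simp

lemma lambert_mult_nth:
  "(lambert g * lambert h) $ n = (\<Sum>(a, b, x, y) \<in> sols n. g a * h b)"
proof -
  let ?F = "\<lambda>n. {(a, x). 0 < a \<and> 0 < x \<and> a * x = (n::nat)}"
  have "(lambert g * lambert h) $ n =
      (\<Sum>i=0..n. \<Sum>((a, x), (b, y)) \<in> ?F i \<times> ?F (n - i). g a * h b)"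
    unfolding fps_mult_nth lambert_nth_pairs sum_product
    by (intro sum.cong refl, subst sum.cartesian_product) (simp add: case_prod_unfold)
  also have "\<dots> = (\<Sum>(i, (a, x), (b, y)) \<in> (SIGMA i : {0..n}. ?F i \<times> ?F (n - i)). g a * h b)"
    by (subst sum.Sigma) (auto simp: case_prod_unfold intro!: finite_cartesian_product finite_factor_pairs [unfolded case_prod_unfold])
  also have "\<dots> = (\<Sum>(a, b, x, y) \<in> sols n. g a * h b)"
    by (rule sum.reindex_bij_witness[of _ "\<lambda>(a, b, x, y). (a * x, (a, x), (b, y))"
          "\<lambda>(i, (a, x), (b, y)). (a, b, x, y)"]) auto
  finally show ?thesis .
qed

definition theta :: "'a :: comm_ring_1 fps \<Rightarrow> 'a fps" where
  "theta f = fps_X * fps_deriv f"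

lemma theta_nth: "theta f $ n = of_nat n * f $ n"
  by (cases n) (simp_all add: theta_def)

lemma theta_add: "theta (f + g) = theta f + theta g"
  and theta_diff: "theta (f - g) = theta f - theta g"
  and theta_mult: "theta (f * g) = theta f * g + f * theta g"
  and theta_1: "theta 1 = 0"
  and theta_numeral_mult: "theta (numeral k * f) = numeral k * theta f"
  by (simp_all add: theta_def algebra_simps fps_deriv_numeral)

lemma lambert_add: "lambert g + lambert h = lambert (\<lambda>d. g d + h d)"
  and lambert_diff: "lambert g - lambert h = lambert (\<lambda>d. g d - h d)"
  by (auto simp: fps_eq_iff lambert_nth sum.distrib sum_subtractf)

lemma lambert_const_mult: "fps_const c * lambert g = lambert (\<lambda>d. c * g d)"
  by (auto simp: fps_eq_iff lambert_nth sum_distrib_left)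

lemma lambert_numeral_mult: "numeral k * lambert g = lambert (\<lambda>d. numeral k * g d)"
  by (simp add: lambert_const_mult numeral_fps_const)

text \<open>Liouville's identity read as an identity of series: the splitting of \<open>f\<close>
  turns the sum over \<open>sols n\<close> into a coefficient of a product, and the terms on the
  divisor side with a factor \<open>n\<close> become \<open>theta\<close>.\<close>

lemma lambert_liouville:
  fixes f :: "nat \<Rightarrow> real"
  assumes "f 0 = 0"
    and lhs: "\<And>a b. f ((a - b) + (b - a)) - f (a + b) = - (g a * h b + h a * g b)"
    and rhs: "\<And>d n. d > 0 \<Longrightarrow>
       (real n / real d - 1) * (2 * f d) - (real d - 1) * f d - 2 * (\<Sum>a=1..<d. f a) = 2 * real n * u d - v d"
  shows "2 * (lambert g * lambert h) + 2 * theta (lambert u) = lambert v"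
proof (rule fps_ext)
  fix n
  show "(2 * (lambert g * lambert h) + 2 * theta (lambert u)) $ n = lambert v $ n"
  proof (cases "n = 0")
    case False
    have "(lambert g * lambert h) $ n + (lambert h * lambert g) $ n =
      - (\<Sum>(a, b, x, y) \<in> sols n. f ((a - b) + (b - a)) - f (a + b))"
      unfolding lambert_mult_nth lhs sum.distrib [symmetric] sum_negf [symmetric]
      by (intro sum.cong) auto
    also have "\<dots> = - (\<Sum>d | d dvd n. (real n / real d - 1) * (f 0 + 2 * f d)
        - (real d - 1) * f d - 2 * (\<Sum>a=1..<d. f a))"
      using False by (subst liouville_identity) auto
    also have "\<dots> = - (\<Sum>d | d dvd n. 2 * real n * u d - v d)"
    proof (rule arg_cong [of _ _ uminus], rule sum.cong)
      fix d assume "d \<in> {d. d dvd n}"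
      hence "d > 0" using False by (auto intro: Nat.gr0I)
      thus "(real n / real d - 1) * (f 0 + 2 * f d)
        - (real d - 1) * f d - 2 * (\<Sum>a=1..<d. f a) = 2 * real n * u d - v d"
        using rhs [of d n] assms(1) by simp
    qed simp
    also have "\<dots> = lambert v $ n - 2 * real n * lambert u $ n"
      using False by (simp add: lambert_nth sum_subtractf sum_distrib_left)
    finally show ?thesis
      by (simp add: theta_nth mult.commute [of "lambert h"] numeral_fps_const)
  qed (simp add: lambert_nth theta_nth)
qed

section \<open>Four instances of Liouville's identity\<close>

abbreviation "lam k \<equiv> lambert (\<lambda>d. real d ^ k)"
abbreviation "mu k \<equiv> lambert (\<lambda>d. (-1) ^ d * real d ^ k)"

lemma sum_power2_less: "d > 0 \<Longrightarrow> (\<Sum>a=1..<d. real a ^ 2) = real d * (real d - 1) * (2 * real d - 1) / 6"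
  by (induction d rule: nat_induct_non_zero) (simp_all add: field_simps power2_eq_square)

lemma sum_power4_less: "d > 0 \<Longrightarrow>
    (\<Sum>a=1..<d. real a ^ 4) = real d ^ 5 / 5 - real d ^ 4 / 2 + real d ^ 3 / 3 - real d / 30"
  by (induction d rule: nat_induct_non_zero) (simp_all add: field_simps power_numeral_reduce)

lemma sum_alternating_power2_less: "d > 0 \<Longrightarrow>
    (\<Sum>a=1..<d. (-1) ^ a * real a ^ 2) = - ((-1) ^ d * (real d ^ 2 - real d) / 2)"
  by (induction d rule: nat_induct_non_zero) (simp_all add: field_simps power_numeral_reduce)

lemma sum_alternating_power4_less: "d > 0 \<Longrightarrow>
    (\<Sum>a=1..<d. (-1) ^ a * real a ^ 4) = - ((-1) ^ d * (real d ^ 4 - 2 * real d ^ 3 + real d) / 2)"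
  by (induction d rule: nat_induct_non_zero) (simp_all add: field_simps power_numeral_reduce)

lemma of_nat_dist_power2: "real ((a - b) + (b - a)) ^ 2 = (real a - real b) ^ 2"
  by (cases "a \<le> b") (simp_all add: of_nat_diff power2_commute)

lemma of_nat_dist_power4: "real ((a - b) + (b - a)) ^ 4 = (real a - real b) ^ 4"
  using arg_cong [OF of_nat_dist_power2 [of a b], of "\<lambda>x. x ^ 2"] by (simp only: power_mult [symmetric]) simp

lemma minus_one_power_dist: "(-1 :: real) ^ ((a - b) + (b - a)) = (-1) ^ (a + b)"
  by (cases "a \<le> b") (auto simp: minus_one_power_iff)

text \<open>Comes from \<open>(a - b)^2 - (a + b)^2 = -4 * a * b\<close>; the factor 3 in the test
  function clears the denominators of the power sum.\<close>

lemma lam1_sq: "12 * (lam 1 * lam 1) + 6 * theta (lam 1) = 5 * lam 3 + lam 1"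
proof -
  have "2 * (lam 1 * lambert (\<lambda>d. 6 * real d ^ 1)) + 2 * theta (lambert (\<lambda>d. 3 * real d ^ 1)) =
      lambert (\<lambda>d. 5 * real d ^ 3 + real d ^ 1)"
  proof (rule lambert_liouville [of "\<lambda>d. 3 * real d ^ 2"])
    fix a b :: nat
    show "3 * real ((a - b) + (b - a)) ^ 2 - 3 * real (a + b) ^ 2 =
        - (real a ^ 1 * (6 * real b ^ 1) + 6 * real a ^ 1 * real b ^ 1)"
      unfolding of_nat_dist_power2 by (simp add: algebra_simps power2_eq_square)
  next
    fix d n :: nat assume "d > 0"
    thus "(real n / real d - 1) * (2 * (3 * real d ^ 2)) - (real d - 1) * (3 * real d ^ 2)
        - 2 * (\<Sum>a=1..<d. 3 * real a ^ 2) = 2 * real n * (3 * real d ^ 1) - (5 * real d ^ 3 + real d ^ 1)"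
      unfolding sum_distrib_left [symmetric] sum_power2_less [OF \<open>d > 0\<close>]
      by (simp add: field_simps power_numeral_reduce)
  qed simp
  thus ?thesis
    unfolding lambert_numeral_mult [symmetric] lambert_add [symmetric] theta_numeral_mult
    by (simp add: algebra_simps)
qed

text \<open>Comes from \<open>(a - b)^4 - (a + b)^4 = -8 * (a^3 * b + a * b^3)\<close>; the factor
  15 clears the denominators of the power sum.\<close>

lemma lam1_lam3: "240 * (lam 1 * lam 3) + 30 * theta (lam 3) = 21 * lam 5 + 10 * lam 3 - lam 1"
proof -
  have "2 * (lam 1 * lambert (\<lambda>d. 120 * real d ^ 3)) + 2 * theta (lambert (\<lambda>d. 15 * real d ^ 3)) =
      lambert (\<lambda>d. 21 * real d ^ 5 + 10 * real d ^ 3 - real d ^ 1)"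
  proof (rule lambert_liouville [of "\<lambda>d. 15 * real d ^ 4"])
    fix a b :: nat
    show "15 * real ((a - b) + (b - a)) ^ 4 - 15 * real (a + b) ^ 4 =
        - (real a ^ 1 * (120 * real b ^ 3) + 120 * real a ^ 3 * real b ^ 1)"
      unfolding of_nat_dist_power4 by (simp add: algebra_simps power_numeral_reduce)
  next
    fix d n :: nat assume "d > 0"
    thus "(real n / real d - 1) * (2 * (15 * real d ^ 4)) - (real d - 1) * (15 * real d ^ 4)
        - 2 * (\<Sum>a=1..<d. 15 * real a ^ 4) =
        2 * real n * (15 * real d ^ 3) - (21 * real d ^ 5 + 10 * real d ^ 3 - real d ^ 1)"
      unfolding sum_distrib_left [symmetric] sum_power4_less [OF \<open>d > 0\<close>]
      by (simp add: field_simps power_numeral_reduce)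
  qed simp
  thus ?thesis
    unfolding lambert_numeral_mult [symmetric] lambert_add [symmetric] lambert_diff [symmetric]
      theta_numeral_mult
    by (simp add: algebra_simps)
qed

text \<open>Since \<open>a - b\<close> and \<open>a + b\<close> have the same parity, the sign
  factors as \<open>(-1)^a * (-1)^b\<close> and the splitting of \<open>x^2\<close> carries over;
  likewise for \<open>x^4\<close> in \<open>mu1_mu3\<close>.\<close>

lemma mu1_sq: "4 * (mu 1 * mu 1) + 2 * theta (mu 1) = mu 3 + mu 1"
proof -
  have "2 * (mu 1 * lambert (\<lambda>d. 2 * ((-1) ^ d * real d ^ 1))) + 2 * theta (mu 1) =
      lambert (\<lambda>d. (-1) ^ d * real d ^ 3 + (-1) ^ d * real d ^ 1)"
  proof (rule lambert_liouville [of "\<lambda>d. (-1) ^ d * real d ^ 2"])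
    fix a b :: nat
    show "(-1) ^ ((a - b) + (b - a)) * real ((a - b) + (b - a)) ^ 2 - (-1) ^ (a + b) * real (a + b) ^ 2 =
        - ((-1) ^ a * real a ^ 1 * (2 * ((-1) ^ b * real b ^ 1)) + 2 * ((-1) ^ a * real a ^ 1) * ((-1) ^ b * real b ^ 1))"
      unfolding of_nat_dist_power2 minus_one_power_dist by (simp add: algebra_simps power2_eq_square power_add)
  next
    fix d n :: nat assume "d > 0"
    thus "(real n / real d - 1) * (2 * ((-1) ^ d * real d ^ 2)) - (real d - 1) * ((-1) ^ d * real d ^ 2)
        - 2 * (\<Sum>a=1..<d. (-1) ^ a * real a ^ 2) =
        2 * real n * ((-1) ^ d * real d ^ 1) - ((-1) ^ d * real d ^ 3 + (-1) ^ d * real d ^ 1)"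
      unfolding sum_alternating_power2_less [OF \<open>d > 0\<close>]
      by (simp add: field_simps power_numeral_reduce)
  qed simp
  thus ?thesis
    unfolding lambert_numeral_mult [symmetric] lambert_add [symmetric] theta_numeral_mult
    by (simp add: algebra_simps)
qed

lemma mu1_mu3: "16 * (mu 1 * mu 3) + 2 * theta (mu 3) = mu 5 + 2 * mu 3 - mu 1"
proof -
  have "2 * (mu 1 * lambert (\<lambda>d. 8 * ((-1) ^ d * real d ^ 3))) + 2 * theta (mu 3) =
      lambert (\<lambda>d. (-1) ^ d * real d ^ 5 + 2 * ((-1) ^ d * real d ^ 3) - (-1) ^ d * real d ^ 1)"
  proof (rule lambert_liouville [of "\<lambda>d. (-1) ^ d * real d ^ 4"])
    fix a b :: nat
    show "(-1) ^ ((a - b) + (b - a)) * real ((a - b) + (b - a)) ^ 4 - (-1) ^ (a + b) * real (a + b) ^ 4 =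
        - ((-1) ^ a * real a ^ 1 * (8 * ((-1) ^ b * real b ^ 3)) + 8 * ((-1) ^ a * real a ^ 3) * ((-1) ^ b * real b ^ 1))"
      unfolding of_nat_dist_power4 minus_one_power_dist by (simp add: algebra_simps power_numeral_reduce power_add)
  next
    fix d n :: nat assume "d > 0"
    thus "(real n / real d - 1) * (2 * ((-1) ^ d * real d ^ 4)) - (real d - 1) * ((-1) ^ d * real d ^ 4)
        - 2 * (\<Sum>a=1..<d. (-1) ^ a * real a ^ 4) =
        2 * real n * ((-1) ^ d * real d ^ 3) -
        ((-1) ^ d * real d ^ 5 + 2 * ((-1) ^ d * real d ^ 3) - (-1) ^ d * real d ^ 1)"
      unfolding sum_alternating_power4_less [OF \<open>d > 0\<close>]
      by (simp add: field_simps power_numeral_reduce)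
  qed simp
  thus ?thesis
    unfolding lambert_numeral_mult [symmetric] lambert_add [symmetric] lambert_diff [symmetric]
      theta_numeral_mult
    by (simp add: algebra_simps)
qed

section \<open>Replacing \<open>q\<close> by \<open>q^2\<close>\<close>

lemma fps_compose_X_square_nth:
  "(f oo fps_X ^ 2 :: 'a :: comm_ring_1 fps) $ n = (if even n then f $ (n div 2) else 0)"
proof -
  have "(f oo fps_X ^ 2) $ n = (\<Sum>i=0..n. if i = n div 2 then (if even n then f $ i else 0) else 0)"
    unfolding fps_compose_nth power_mult [symmetric]
    by (intro sum.cong) auto
  thus ?thesis by simp
qed

lemma theta_compose_X_square:
  "theta (f oo fps_X ^ 2 :: real fps) = 2 * (theta f oo fps_X ^ 2)"
proof (rule fps_ext)
  fix n
  show "theta (f oo fps_X ^ 2) $ n = (2 * (theta f oo fps_X ^ 2)) $ n"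
    by (cases "even n") (simp_all add: theta_nth fps_compose_X_square_nth numeral_fps_const real_of_nat_div)
qed

lemma compose_X_square_distribs:
  fixes f g :: "real fps"
  shows "(f + g) oo fps_X ^ 2 = (f oo fps_X ^ 2) + (g oo fps_X ^ 2)"
    and "(f - g) oo fps_X ^ 2 = (f oo fps_X ^ 2) - (g oo fps_X ^ 2)"
    and "(f * g) oo fps_X ^ 2 = (f oo fps_X ^ 2) * (g oo fps_X ^ 2)"
    and "(numeral k * f) oo fps_X ^ 2 = numeral k * (f oo fps_X ^ 2)"
    and "(1 :: real fps) oo fps_X ^ 2 = 1"
  by (simp_all add: fps_compose_add_distrib fps_compose_sub_distrib fps_compose_mult_distrib
        numeral_fps_const)

text \<open>Adding \<open>lam k\<close> to \<open>mu k\<close> cancels the odd divisors and doubles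
  the even ones; an even divisor is \<open>2 * e\<close> with \<open>e\<close> dividing
  \<open>n div 2\<close>.\<close>

lemma mu_eq_lam: "mu k = 2 ^ Suc k * (lam k oo fps_X ^ 2) - lam k"
proof (rule fps_ext)
  fix n
  have c: "(2 :: real fps) ^ Suc k = fps_const (2 ^ Suc k)"
    by (simp only: numeral_fps_const fps_const_power)
  show "mu k $ n = (2 ^ Suc k * (lam k oo fps_X ^ 2) - lam k) $ n"
  proof (cases "n = 0")
    case False
    have "mu k $ n + lam k $ n = (\<Sum>d | d dvd n. (if even d then 2 * real d ^ k else 0))"
      using False by (auto simp: lambert_nth sum.distrib [symmetric] intro!: sum.cong)
    also have "\<dots> = (\<Sum>d | d dvd n \<and> even d. 2 * real d ^ k)"
      using False by (intro sum.mono_neutral_cong_right) auto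
    also have "\<dots> = (if even n then (\<Sum>e | e dvd n div 2. 2 * real (2 * e) ^ k) else 0)"
    proof (cases "even n")
      case True
      then obtain m where n: "n = 2 * m" by (elim evenE)
      have "(\<Sum>d | d dvd n \<and> even d. 2 * real d ^ k) = (\<Sum>e | e dvd m. 2 * real (2 * e) ^ k)"
        by (rule sum.reindex_bij_witness[of _ "\<lambda>e. 2 * e" "\<lambda>d. d div 2"]) (auto simp: n elim!: evenE)
      thus ?thesis by (simp add: n)
    next
      case odd: False
      hence "{d. d dvd n \<and> even d} = {}" using dvd_trans by blast
      thus ?thesis using odd by (simp only: sum.empty if_False)
    qed
    also have "\<dots> = (2 ^ Suc k * (lam k oo fps_X ^ 2)) $ n"
    proof (cases "even n")
      case True
      hence "n div 2 \<noteq> 0" using False by auto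
      thus ?thesis unfolding c using True
        by (simp add: fps_compose_X_square_nth lambert_nth sum_distrib_left power_mult_distrib mult.assoc)
    qed (simp only: c fps_mult_left_const_nth fps_compose_X_square_nth if_False mult_zero_right)
    finally show ?thesis by (simp add: algebra_simps)
  qed (simp add: lambert_nth fps_compose_X_square_nth)
qed

text \<open>\<open>eis2\<close>, \<open>eis4\<close>, \<open>eis6\<close> are the Eisenstein series \<open>P\<close>, \<open>Q\<close>, \<open>R\<close> of Ramanujan, and the suffix
  \<open>_sq\<close> marks the argument \<open>q\<^sup>2\<close>; \<open>alt4\<close> and \<open>alt6\<close> are \<open>-16\<close> and \<open>8\<close> times the generating functions
  of \<open>sigma_star 3\<close> and \<open>sigma_star 5\<close>.\<close>

definition eis2 :: "real fps" where "eis2 = 1 - 24 * lam 1"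
definition eis4 :: "real fps" where "eis4 = 1 + 240 * lam 3"
definition eis6 :: "real fps" where "eis6 = 1 - 504 * lam 5"
definition eis2_sq :: "real fps" where "eis2_sq = eis2 oo fps_X ^ 2"
definition eis4_sq :: "real fps" where "eis4_sq = eis4 oo fps_X ^ 2"
definition eis6_sq :: "real fps" where "eis6_sq = eis6 oo fps_X ^ 2"
definition alt2 :: "real fps" where "alt2 = 1 - 8 * mu 1"
definition alt4 :: "real fps" where "alt4 = 1 + 16 * mu 3"
definition alt6 :: "real fps" where "alt6 = 1 - 8 * mu 5"
text \<open>For \<open>n > 0\<close> its coefficient is 24 times the sum of the odd divisors of
  \<open>n\<close>.\<close>

definition odd2 :: "real fps" where "odd2 = 2 * eis2_sq - eis2"

section \<open>Differential equations of the Eisenstein series\<close>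

lemmas theta_simps = theta_add theta_diff theta_1 theta_numeral_mult

text \<open>Here and in the next three lemmas, the difference of the two sides is a constant
  multiple of one of the Lambert series identities above.\<close>

lemma theta_eis2: "12 * theta eis2 = eis2 * eis2 - eis4"
proof -
  have "12 * theta eis2 - (eis2 * eis2 - eis4) =
      - 48 * (12 * (lam 1 * lam 1) + 6 * theta (lam 1) - (5 * lam 3 + lam 1))"
    unfolding eis2_def eis4_def theta_simps by (simp add: algebra_simps)
  thus ?thesis by (simp only: lam1_sq diff_self mult_zero_right right_minus_eq)
qed

lemma theta_eis4: "3 * theta eis4 = eis2 * eis4 - eis6"
proof -
  have "3 * theta eis4 - (eis2 * eis4 - eis6) =
      24 * (240 * (lam 1 * lam 3) + 30 * theta (lam 3) - (21 * lam 5 + 10 * lam 3 - lam 1))"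
    unfolding eis2_def eis4_def eis6_def theta_simps by (simp add: algebra_simps)
  thus ?thesis by (simp only: lam1_lam3 diff_self mult_zero_right right_minus_eq)
qed

lemma theta_alt2: "4 * theta alt2 = alt2 * alt2 - alt4"
proof -
  have "4 * theta alt2 - (alt2 * alt2 - alt4) =
      - 16 * (4 * (mu 1 * mu 1) + 2 * theta (mu 1) - (mu 3 + mu 1))"
    unfolding alt2_def alt4_def theta_simps by (simp add: algebra_simps)
  thus ?thesis by (simp only: mu1_sq diff_self mult_zero_right right_minus_eq)
qed

lemma theta_alt4: "theta alt4 = alt2 * alt4 - alt6"
proof -
  have "theta alt4 - (alt2 * alt4 - alt6) =
      8 * (16 * (mu 1 * mu 3) + 2 * theta (mu 3) - (mu 5 + 2 * mu 3 - mu 1))"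
    unfolding alt2_def alt4_def alt6_def theta_simps by (simp add: algebra_simps)
  thus ?thesis by (simp only: mu1_mu3 diff_self mult_zero_right right_minus_eq)
qed

lemma theta_eis2_sq: "6 * theta eis2_sq = eis2_sq * eis2_sq - eis4_sq"
proof -
  have "6 * theta eis2_sq = (12 * theta eis2) oo fps_X ^ 2"
    unfolding eis2_sq_def theta_compose_X_square compose_X_square_distribs by simp
  also have "\<dots> = eis2_sq * eis2_sq - eis4_sq"
    unfolding theta_eis2 compose_X_square_distribs eis2_sq_def eis4_sq_def by simp
  finally show ?thesis .
qed

lemma theta_eis4_sq: "3 * theta eis4_sq = 2 * (eis2_sq * eis4_sq - eis6_sq)"
proof -
  have "3 * theta eis4_sq = 2 * ((3 * theta eis4) oo fps_X ^ 2)"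
    unfolding eis4_sq_def theta_compose_X_square compose_X_square_distribs by (simp add: algebra_simps)
  also have "(3 * theta eis4) oo fps_X ^ 2 = eis2_sq * eis4_sq - eis6_sq"
    unfolding theta_eis4 compose_X_square_distribs eis2_sq_def eis4_sq_def eis6_sq_def by simp
  finally show ?thesis .
qed

text \<open>By \<open>mu_eq_lam\<close>, where \<open>2 ^ Suc k\<close> is 4, 16 and 64; the
  constant terms then force the factors 3, 15 and 63.\<close>

lemma alt2_eq: "3 * alt2 = 4 * eis2_sq - eis2"
  and alt4_eq: "15 * alt4 = 16 * eis4_sq - eis4"
  and alt6_eq: "63 * alt6 = 64 * eis6_sq - eis6"
  unfolding alt2_def alt4_def alt6_def eis2_sq_def eis4_sq_def eis6_sq_def eis2_def eis4_def eis6_def compose_X_square_distribs mu_eq_lam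
  by (simp_all add: algebra_simps)

section \<open>Algebraic relations from comparing the two systems\<close>

lemma theta_odd2: "12 * theta odd2 = 4 * (eis2_sq * eis2_sq - eis4_sq) - (eis2 * eis2 - eis4)"
  unfolding odd2_def theta_simps theta_eis2 [symmetric] theta_eis2_sq [symmetric] by (simp add: algebra_simps)

text \<open>\<open>theta alt2\<close> is known from \<open>theta_alt2\<close>, and also from
  applying \<open>theta\<close> to \<open>alt2_eq\<close>. Equating the two eliminates all
  derivatives and leaves twice this relation.\<close>

lemma odd2_sq: "5 * (odd2 * odd2) = eis4 + 4 * eis4_sq"
proof -
  have t: "3 * theta alt2 = 4 * theta eis2_sq - theta eis2"
    using arg_cong [OF alt2_eq, of theta] by (simp add: theta_simps)
  have "5 * ((3 * alt2) * (3 * alt2)) - 3 * (15 * alt4) = 45 * (alt2 * alt2 - alt4)"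
    by (simp add: algebra_simps)
  also have "\<dots> = 60 * (3 * theta alt2)"
    unfolding theta_alt2 [symmetric] by simp
  also have "\<dots> = 40 * (6 * theta eis2_sq) - 5 * (12 * theta eis2)"
    unfolding t by (simp add: algebra_simps)
  finally have e: "5 * ((4 * eis2_sq - eis2) * (4 * eis2_sq - eis2)) - 3 * (16 * eis4_sq - eis4) =
      40 * (eis2_sq * eis2_sq - eis4_sq) - 5 * (eis2 * eis2 - eis4)"
    unfolding alt2_eq alt4_eq theta_eis2 theta_eis2_sq .
  have "2 * (5 * (odd2 * odd2) - (eis4 + 4 * eis4_sq)) =
      5 * ((4 * eis2_sq - eis2) * (4 * eis2_sq - eis2)) - 3 * (16 * eis4_sq - eis4) - (40 * (eis2_sq * eis2_sq - eis4_sq) - 5 * (eis2 * eis2 - eis4))"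
    by (simp add: odd2_def algebra_simps)
  thus ?thesis by (simp only: e diff_self right_minus_eq mult_eq_0_iff zero_neq_numeral [symmetric] simp_thms)
qed

lemma numeral_mult_diff_cancel:
  fixes x y :: "real fps"
  assumes "numeral k * (x - y) = 0"
  shows "x = y"
  using assms by (simp only: right_minus_eq mult_eq_0_iff zero_neq_numeral [symmetric] simp_thms)

text \<open>The same elimination for \<open>theta alt4\<close>, computed from
  \<open>theta_alt4\<close> and from \<open>alt4_eq\<close>.\<close>

lemma odd2_eis6_first: "7 * odd2 * (8 * eis4_sq - eis4) = 48 * eis6_sq + eis6"
proof -
  have t: "15 * theta alt4 = 16 * theta eis4_sq - theta eis4"
    using arg_cong [OF alt4_eq, of theta] by (simp add: theta_simps)
  have "7 * (3 * alt2) * (15 * alt4) - 5 * (63 * alt6) = 315 * (alt2 * alt4 - alt6)"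
    by (simp add: algebra_simps)
  also have "\<dots> = 21 * (15 * theta alt4)"
    unfolding theta_alt4 [symmetric] by simp
  also have "\<dots> = 7 * (16 * (3 * theta eis4_sq) - 3 * theta eis4)"
    unfolding t by (simp add: algebra_simps)
  finally have e: "7 * (4 * eis2_sq - eis2) * (16 * eis4_sq - eis4) - 5 * (64 * eis6_sq - eis6) =
      7 * (16 * (2 * (eis2_sq * eis4_sq - eis6_sq)) - (eis2 * eis4 - eis6))"
    unfolding alt2_eq alt4_eq alt6_eq theta_eis4 theta_eis4_sq .
  have "2 * (7 * odd2 * (8 * eis4_sq - eis4) - (48 * eis6_sq + eis6)) =
      7 * (4 * eis2_sq - eis2) * (16 * eis4_sq - eis4) - 5 * (64 * eis6_sq - eis6) -
      (7 * (16 * (2 * (eis2_sq * eis4_sq - eis6_sq)) - (eis2 * eis4 - eis6)))"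
    by (simp add: odd2_def algebra_simps)
  thus ?thesis unfolding e diff_self by (rule numeral_mult_diff_cancel)
qed

text \<open>A second relation for \<open>eis6\<close> and \<open>eis6_sq\<close>, obtained by
  applying \<open>theta\<close> to \<open>odd2_sq\<close>.\<close>

lemma odd2_eis6_second: "3 * odd2 * (4 * eis4_sq - eis4) = 8 * eis6_sq + eis6"
proof -
  have t: "5 * (theta odd2 * odd2 + odd2 * theta odd2) = theta eis4 + 4 * theta eis4_sq"
    using arg_cong [OF odd2_sq, of theta]
    unfolding theta_add theta_numeral_mult unfolding theta_mult .
  have "5 * odd2 * (12 * theta odd2) = 6 * (5 * (theta odd2 * odd2 + odd2 * theta odd2))"
    by (simp add: algebra_simps)
  also have "\<dots> = 2 * (3 * theta eis4) + 8 * (3 * theta eis4_sq)"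
    unfolding t by (simp add: algebra_simps)
  finally have e: "5 * odd2 * (4 * (eis2_sq * eis2_sq - eis4_sq) - (eis2 * eis2 - eis4)) =
      2 * (eis2 * eis4 - eis6) + 8 * (2 * (eis2_sq * eis4_sq - eis6_sq))"
    unfolding theta_odd2 theta_eis4 theta_eis4_sq .
  \<comment> \<open>Because \<open>4 * eis2_sq^2 - eis2^2 = odd2 * (2 * eis2_sq + eis2)\<close>, the
    remaining \<open>eis2\<close> and \<open>eis2_sq\<close> are removed by a multiple of
    \<open>odd2_sq\<close>, the last summand.\<close>
  have "2 * (8 * eis6_sq + eis6 - 3 * odd2 * (4 * eis4_sq - eis4)) =
      5 * odd2 * (4 * (eis2_sq * eis2_sq - eis4_sq) - (eis2 * eis2 - eis4)) - (2 * (eis2 * eis4 - eis6) + 8 * (2 * (eis2_sq * eis4_sq - eis6_sq)))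
      + (eis4 + 4 * eis4_sq - 5 * (odd2 * odd2)) * (2 * eis2_sq + eis2)"
    by (simp add: odd2_def algebra_simps)
  hence "2 * (8 * eis6_sq + eis6 - 3 * odd2 * (4 * eis4_sq - eis4)) = 0"
    unfolding e odd2_sq by simp
  thus ?thesis by (rule numeral_mult_diff_cancel [symmetric])
qed

lemma alt6_eq_odd2_alt4: "alt6 = odd2 * alt4"
proof (rule numeral_mult_diff_cancel)
  have "315 * (alt6 - odd2 * alt4) = 5 * (63 * alt6) - 21 * odd2 * (15 * alt4)"
    by (simp add: algebra_simps)
  \<comment> \<open>The weights 9 and -14 solve \<open>48 * s + 8 * t = 320\<close> and
    \<open>s + t = -5\<close>, the coefficients of \<open>eis6_sq\<close> and \<open>eis6\<close> in
    \<open>315 * alt6\<close>.\<close>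
  also have "\<dots> = 9 * (48 * eis6_sq + eis6 - 7 * odd2 * (8 * eis4_sq - eis4)) - 14 * (8 * eis6_sq + eis6 - 3 * odd2 * (4 * eis4_sq - eis4))"
    unfolding alt6_eq alt4_eq by (simp add: algebra_simps)
  also have "\<dots> = 0" unfolding odd2_eis6_first odd2_eis6_second by simp
  finally show "315 * (alt6 - odd2 * alt4) = 0" .
qed

lemma theta_odd2_alt: "2 * theta odd2 = odd2 * alt2 - alt4"
proof (rule numeral_mult_diff_cancel)
  have "30 * (2 * theta odd2 - (odd2 * alt2 - alt4)) = 5 * (12 * theta odd2) - 10 * odd2 * (3 * alt2) + 2 * (15 * alt4)"
    by (simp add: algebra_simps)
  also have "\<dots> = 3 * (eis4 + 4 * eis4_sq - 5 * (odd2 * odd2))"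
    unfolding theta_odd2 alt2_eq alt4_eq by (simp add: odd2_def algebra_simps)
  also have "\<dots> = 0" unfolding odd2_sq by simp
  finally show "30 * (2 * theta odd2 - (odd2 * alt2 - alt4)) = 0" .
qed

lemma theta_alt4_log: "theta alt4 = (alt2 - odd2) * alt4"
  unfolding theta_alt4 alt6_eq_odd2_alt4 by (simp add: algebra_simps)

text \<open>Up to a factor 2 the left side is the Rankin-Cohen bracket of forms of weights 4 and 6,
  hence of weight 12; the terms with \<open>alt2\<close> cancel.\<close>

lemma bracket_eq: "2 * alt4 * theta alt6 - 3 * alt6 * theta alt4 = alt4 * alt4 * (odd2 * odd2 - alt4)"
proof -
  have "2 * alt4 * theta alt6 - 3 * alt6 * theta alt4 = alt4 * alt4 * (2 * theta odd2) - odd2 * alt4 * theta alt4"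
    unfolding alt6_eq_odd2_alt4 theta_mult by (simp add: algebra_simps)
  also have "\<dots> = alt4 * alt4 * (odd2 * odd2 - alt4)"
    unfolding theta_odd2_alt theta_alt4_log by (simp add: algebra_simps)
  finally show ?thesis .
qed

text \<open>The factor \<open>alt4\<close> has logarithmic derivative \<open>alt2 - odd2\<close>,
  and \<open>odd2 * odd2 - alt4\<close> has \<open>alt2\<close>.\<close>

lemma theta_bracket:
  "theta (alt4 * alt4 * (odd2 * odd2 - alt4)) = eis2 * (alt4 * alt4 * (odd2 * odd2 - alt4))"
proof -
  have P: "eis2 = 3 * alt2 - 2 * odd2" unfolding alt2_eq odd2_def by simp
  have "theta (alt4 * alt4 * (odd2 * odd2 - alt4)) =
      2 * alt4 * theta alt4 * (odd2 * odd2 - alt4) + alt4 * alt4 * (odd2 * (2 * theta odd2) - theta alt4)"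
    unfolding theta_mult theta_diff by (simp add: algebra_simps)
  also have "\<dots> = eis2 * (alt4 * alt4 * (odd2 * odd2 - alt4))"
    unfolding theta_odd2_alt theta_alt4_log P by (simp add: algebra_simps)
  finally show ?thesis .
qed

section \<open>Logarithmic derivatives and the product defining tau\<close>

text \<open>As \<open>h\<close> has constant term 1, comparing coefficients determines
  \<open>(n - 1)\<close> times the \<open>n\<close>-th coefficient from the lower ones, so only the
  coefficient at 1 is free.\<close>

lemma theta_eq_unique:
  fixes f g h :: "real fps"
  assumes "theta f = h * f" "theta g = h * g" "h $ 0 = 1" "f $ 1 = g $ 1"
  shows "f = g"
proof -
  define e where "e = f - g"
  have e: "theta e = h * e"
    using assms by (simp add: e_def theta_diff algebra_simps)
  have "e $ n = 0" for n
  proof (induction n rule: less_induct)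
    case (less n)
    have "real n * e $ n = (\<Sum>i=0..n. h $ i * e $ (n - i))"
      using arg_cong [OF e, of "\<lambda>f. f $ n"] by (simp add: theta_nth fps_mult_nth)
    also have "\<dots> = (\<Sum>i\<in>{0}. h $ i * e $ (n - i))"
      by (rule sum.mono_neutral_right) (auto intro!: less)
    finally have "(real n - 1) * e $ n = 0" using assms(3) by (simp add: algebra_simps)
    moreover have "e $ 1 = 0" using assms(4) by (simp add: e_def)
    ultimately show ?case by (cases "n = 1") auto
  qed
  hence "e = 0" by (simp add: fps_eq_iff)
  thus ?thesis by (simp add: e_def)
qed

text \<open>\<open>geom m\<close> is the series of \<open>m X\<^sup>m / (1 - X\<^sup>m)\<close>.\<close>

definition geom :: "nat \<Rightarrow> int fps" where
  "geom m = Abs_fps (\<lambda>n. if n > 0 \<and> m dvd n then int m else 0)"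

lemma geom_mult:
  assumes "m > 0"
  shows "geom m * (1 - fps_X ^ m) = of_nat m * fps_X ^ m"
proof (rule fps_ext)
  fix n
  have "(geom m * (1 - fps_X ^ m)) $ n = geom m $ n - (if n < m then 0 else geom m $ (n - m))"
    by (simp add: right_diff_distrib fps_X_power_mult_right_nth)
  also have "\<dots> = (if n = m then int m else 0)"
    using assms by (auto simp: geom_def dest: dvd_imp_le intro: dvd_diff_nat) (metis dvd_diffD dvd_refl not_less)
  also have "\<dots> = (of_nat m * fps_X ^ m) $ n"
    by (simp add: fps_of_nat [symmetric])
  finally show "(geom m * (1 - fps_X ^ m)) $ n = (of_nat m * fps_X ^ m) $ n" .
qed

lemma theta_X_power: "theta (fps_X ^ m) = of_nat m * fps_X ^ m"
  by (rule fps_ext) (simp add: theta_nth fps_of_nat [symmetric])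

lemma theta_power: "theta (f ^ n) = of_nat n * theta f * f ^ (n - 1)"
  by (simp add: theta_def fps_deriv_power' mult_ac)

lemma theta_factor:
  assumes "m > 0"
  shows "theta ((1 - fps_X ^ m) ^ 24 :: int fps) = - 24 * geom m * (1 - fps_X ^ m) ^ 24"
proof -
  have "theta ((1 - fps_X ^ m) ^ 24 :: int fps) = - 24 * (of_nat m * fps_X ^ m) * (1 - fps_X ^ m) ^ 23"
    unfolding theta_power [of "1 - fps_X ^ m"] theta_diff theta_1 theta_X_power by simp
  also have "\<dots> = - 24 * geom m * ((1 - fps_X ^ m) * (1 - fps_X ^ m) ^ 23)"
    unfolding geom_mult [OF assms, symmetric] by (simp only: mult_ac)
  also have "(1 - fps_X ^ m) * (1 - fps_X ^ m) ^ 23 = ((1 - fps_X ^ m) ^ 24 :: int fps)"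
    by (simp flip: power_Suc)
  finally show ?thesis .
qed

text \<open>The logarithmic derivative of the partial product, stated without division so that it
  makes sense over the integers.\<close>

lemma theta_partial_prod:
  "theta (\<Prod>i\<le>N. (1 - fps_X ^ Suc i) ^ 24 :: int fps) =
     - 24 * (\<Sum>i\<le>N. geom (Suc i)) * (\<Prod>i\<le>N. (1 - fps_X ^ Suc i) ^ 24)"
proof (induction N)
  case 0
  show ?case using theta_factor [of 1] by simp
next
  case (Suc N)
  show ?case
    unfolding prod.atMost_Suc sum.atMost_Suc theta_mult Suc.IH theta_factor [OF zero_less_Suc]
    by (simp only: algebra_simps)
qed

text \<open>Truncation at \<open>N\<close> is harmless because the divisors of a positive
  \<open>k\<close> do not exceed \<open>k\<close>.\<close>

lemma sum_geom_nth:
  assumes "k \<le> N"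
  shows "real_of_int ((\<Sum>i\<le>N. geom (Suc i)) $ k) = lam 1 $ k"
proof (cases "k = 0")
  case False
  have "(\<Sum>i\<le>N. geom (Suc i)) $ k = (\<Sum>i\<le>N. if Suc i dvd k then int (Suc i) else 0)"
    using False by (simp add: fps_sum_nth geom_def)
  also have "\<dots> = (\<Sum>i | i \<le> N \<and> Suc i dvd k. int (Suc i))"
    by (rule sum.mono_neutral_cong_right) auto
  also have "\<dots> = (\<Sum>d | d dvd k. int d)"
  proof (rule sum.reindex_bij_witness[of _ "\<lambda>d. d - 1" Suc])
    fix d assume d: "d \<in> {d. d dvd k}"
    hence "d > 0" "d \<le> k" using False by (auto intro: Nat.gr0I dvd_imp_le)
    thus "Suc (d - 1) = d" "d - 1 \<in> {i. i \<le> N \<and> Suc i dvd k}" using d assms by auto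
  qed auto
  finally show ?thesis using False by (simp add: lambert_nth)
qed (simp add: fps_sum_nth geom_def lambert_nth)

text \<open>X-adic convergence makes each coefficient eventually constant, and
  \<open>tau_fps_coeff_stable\<close> says from where on.\<close>

lemma tau_prod_nth:
  assumes "k \<le> N"
  shows "(\<Prod>n. (1 - fps_X ^ Suc n) ^ 24 :: int fps) $ k = (\<Prod>i\<le>N. (1 - fps_X ^ Suc i) ^ 24) $ k"
proof -
  have "(\<lambda>n. \<Prod>i\<le>n. (1 - fps_X ^ Suc i) ^ 24 :: int fps) \<longlonglongrightarrow> (\<Prod>n. (1 - fps_X ^ Suc n) ^ 24)"
    by (rule has_prod_imp_tendsto [OF tau_fps_has_prod])
  hence "\<forall>\<^sub>F M in sequentially. (\<Prod>i\<le>M. (1 - fps_X ^ Suc i) ^ 24 :: int fps) $ k =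
      (\<Prod>n. (1 - fps_X ^ Suc n) ^ 24) $ k"
    unfolding tendsto_fps_iff by blast
  then obtain M where "M \<ge> k"
    and M: "(\<Prod>i\<le>M. (1 - fps_X ^ Suc i) ^ 24 :: int fps) $ k = (\<Prod>n. (1 - fps_X ^ Suc n) ^ 24) $ k"
    unfolding eventually_sequentially by (meson nat_le_linear)
  thus ?thesis
    using tau_fps_coeff_stable [OF \<open>k \<le> M\<close>] tau_fps_coeff_stable [OF assms] by simp
qed

definition Delta :: "real fps" where
  "Delta = Abs_fps (\<lambda>n. real_of_int (ramanujan_tau n))"

lemma theta_Delta: "theta Delta = eis2 * Delta"
proof -
  define E :: "int fps" where "E = (\<Prod>n. (1 - fps_X ^ Suc n) ^ 24)"
  define E' :: "real fps" where "E' = Abs_fps (\<lambda>n. real_of_int (E $ n))"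
  have tE: "theta E' = - 24 * lam 1 * E'"
proof (rule fps_ext)
    fix n
    let ?p = "\<Prod>i\<le>n. (1 - fps_X ^ Suc i) ^ 24 :: int fps"
    \<comment> \<open>The \<open>n\<close>-th coefficient of either side involves only coefficients
      up to \<open>n\<close>, where the infinite product agrees with this finite one.\<close>
    have E: "E $ k = ?p $ k" if "k \<le> n" for k
      unfolding E_def by (rule tau_prod_nth [OF that])
    have "theta E $ n = theta ?p $ n"
      by (simp add: theta_nth E)
    also have "\<dots> = - 24 * (\<Sum>k=0..n. (\<Sum>i\<le>n. geom (Suc i)) $ k * ?p $ (n - k))"
      unfolding theta_partial_prod mult.assoc
      by (simp only: fps_mult_nth [symmetric] numeral_fps_const fps_const_neg fps_mult_left_const_nth)
    also have "\<dots> = - 24 * (\<Sum>k=0..n. (\<Sum>i\<le>n. geom (Suc i)) $ k * E $ (n - k))"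
      by (simp add: E)
    finally have "real_of_int (theta E $ n) =
        real_of_int (- 24 * (\<Sum>k=0..n. (\<Sum>i\<le>n. geom (Suc i)) $ k * E $ (n - k)))"
      by (rule arg_cong)
    also have "\<dots> = - 24 * (\<Sum>k=0..n. lam 1 $ k * E' $ (n - k))"
      unfolding of_int_mult of_int_sum E'_def fps_nth_Abs_fps
      by (intro arg_cong2 [of _ _ _ _ "(*)"] sum.cong) (rule sum_geom_nth | simp)+
    also have "\<dots> = (- 24 * lam 1 * E') $ n"
      unfolding mult.assoc
      by (simp only: fps_mult_nth [symmetric] numeral_fps_const fps_const_neg fps_mult_left_const_nth)
    finally show "theta E' $ n = (- 24 * lam 1 * E') $ n"
      by (simp add: theta_nth E'_def)
  qed
  have D: "Delta = fps_X * E'"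
    by (rule fps_ext) (simp add: Delta_def ramanujan_tau_def tau_fps_def E_def E'_def)
  have tX: "theta (fps_X :: real fps) = fps_X"
    by (simp add: theta_def)
  \<comment> \<open>The leading factor \<open>fps_X\<close> is fixed by \<open>theta\<close> and
    supplies the constant term 1 of \<open>eis2\<close>.\<close>
  have "theta Delta = fps_X * E' + fps_X * (- 24 * lam 1 * E')"
    unfolding D theta_mult tE tX ..
  also have "\<dots> = eis2 * Delta"
    unfolding eis2_def D by (simp add: algebra_simps)
  finally show ?thesis .
qed

lemma Delta_nth_1: "Delta $ 1 = 1"
proof -
  have "(\<Prod>n. (1 - fps_X ^ Suc n) ^ 24 :: int fps) $ 0 = 1"
    by (subst tau_prod_nth [of 0 0]) (simp_all add: fps_power_zeroth)
  thus ?thesis by (simp add: Delta_def ramanujan_tau_def tau_fps_def)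
qed

section \<open>Identification with \<open>Delta\<close> and comparison of coefficients\<close>

lemma bracket_eq_Delta: "2 * alt4 * theta alt6 - 3 * alt6 * theta alt4 = 64 * Delta"
proof (rule theta_eq_unique)
  show "theta (2 * alt4 * theta alt6 - 3 * alt6 * theta alt4) = eis2 * (2 * alt4 * theta alt6 - 3 * alt6 * theta alt4)"
    unfolding bracket_eq by (rule theta_bracket)
  show "theta (64 * Delta) = eis2 * (64 * Delta)"
    unfolding theta_numeral_mult theta_Delta by (simp only: mult_ac)
  show "eis2 $ 0 = 1" by (simp add: eis2_def lambert_nth)
  have d: "{d. d dvd Suc 0} = {1}" by auto
  \<comment> \<open>The coefficient at 1 is \<open>2 * 8 - 3 * (-16) = 64\<close>, which explains
    the factor of \<open>Delta\<close>.\<close>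
  have "alt4 $ 0 = 1" "alt6 $ 0 = 1" "alt4 $ 1 = -16" "alt6 $ 1 = 8"
    by (simp_all add: alt4_def alt6_def lambert_nth numeral_fps_const d)
  thus "(2 * alt4 * theta alt6 - 3 * alt6 * theta alt4) $ 1 = (64 * Delta) $ 1"
    using Delta_nth_1 by (simp add: numeral_fps_const mult.assoc fps_mult_nth_1 theta_nth)
qed

text \<open>The conventional values of \<open>sigma_star\<close> at 0 are exactly those that give
  \<open>alt4\<close> and, in the next lemma, \<open>alt6\<close> constant term 1.\<close>

lemma sigma_star_3: "alt4 $ n = - 16 * sigma_star 3 n"
  by (simp add: alt4_def sigma_star_def lambert_nth numeral_fps_const)

lemma sigma_star_5: "alt6 $ n = 8 * sigma_star 5 n"
  by (simp add: alt6_def sigma_star_def lambert_nth numeral_fps_const)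

theorem theorem3p13:
  fixes n :: nat
  shows "real_of_int (ramanujan_tau n) =
    2 * (\<Sum>(j, k) | j + k = n. (3 * real j - 2 * real k) * sigma_star 3 j * sigma_star 5 k)"
proof -
  have "64 * real_of_int (ramanujan_tau n) = (64 * Delta) $ n"
    by (simp add: Delta_def numeral_fps_const)
  also have "64 * Delta = fps_const 2 * (alt4 * theta alt6) - fps_const 3 * (theta alt4 * alt6)"
    unfolding bracket_eq_Delta [symmetric] by (simp only: numeral_fps_const mult_ac)
  also have "\<dots> $ n = 2 * (alt4 * theta alt6) $ n - 3 * (theta alt4 * alt6) $ n"
    by simp
  \<comment> \<open>The factor is \<open>128 = 16 * 8\<close>; the negative sign in
    \<open>sigma_star_3\<close> is what makes \<open>3 * j\<close> positive and \<open>2 * k\<close>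
    negative.\<close>
  also have "\<dots> = (\<Sum>j=0..n. 128 * ((3 * real j - 2 * real (n - j)) * sigma_star 3 j * sigma_star 5 (n - j)))"
    unfolding fps_mult_nth theta_nth sigma_star_3 sigma_star_5 sum_distrib_left sum_subtractf [symmetric]
    by (intro sum.cong) (simp_all add: algebra_simps)
  also have "\<dots> = (\<Sum>(j, k) | j + k = n. 128 * ((3 * real j - 2 * real k) * sigma_star 3 j * sigma_star 5 k))"
    by (rule sum.reindex_bij_witness[of _ fst "\<lambda>j. (j, n - j)"]) auto
  also have "\<dots> = 64 * (2 * (\<Sum>(j, k) | j + k = n. (3 * real j - 2 * real k) * sigma_star 3 j * sigma_star 5 k))"
    by (simp add: sum_distrib_left case_prod_unfold)
  finally show ?thesis by simp
qed

end
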